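(* Let $G$ be a group and $m\ge3$. Let $(L,M,N,\phi)$ be an $m$-invariant quadruple for $G$. Then $K=\mathbf{K}_m(L,M,N,\phi)$ is an invariant normal subgroup of $G^m$. Moreover $\mathbf{L}(K)=L$, $\mathbf{M}(K)=M$, $\mathbf{N}(K)=N$ and $\phi_K=\phi$. Conversely, if $K$ is an invariant normal subgroup of $G^m$, then $(\mathbf{L}(K),\mathbf{M}(K),\mathbf{N}(K),\phi_K)$ is an $m$-invariant quadruple for $G$ and $K=\mathbf{K}_m(\mathbf{L}(K),\mathbf{M}(K),\mathbf{N}(K),\phi_K)$.
   Context: Maps are written on the right. A subgroup $K\le G^m$ is (permutation) invariant if for all $\sigma\in\mathcal{S}_m$, $(g_1,\dots,g_m)\in K\iff(g_{1\sigma},\dots,g_{m\sigma})\in K$. For an invariant normal subgroup $K\trianglelefteq G^m$ define $\mathbf{L}(K)$ = the projection of $K$ onto the first coordinate; $\mathbf{H}(K)=\{(g,h)\in G^2\mid(g,h,1,\dots,1)\in K\}$; $\mathbf{M}(K)$ = the projection of $\mathbf{H}(K)$ onto the first coordinate; $\mathbf{N}(K)=\{n\in G\mid(n,1,\dots,1)\in K\}$. These are normal subgroups of $G$ (respectively of $G^2$ for $\mathbf{H}(K)$). The function $\phi_K\colon\mathbf{L}(K)\to\mathbf{L}(K)/\mathbf{N}(K)$ is given by $g\mapsto y\mathbf{N}(K)$ where $y$ is such that $(y,g,g,\dots,g)\in K$ (such $y$ exists and the coset does not depend on its choice). For normal subgroups $N\le M\le L$ of $G$, a homomorphism $\phi\colon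 L\to L/N$ is an $(LMNm)$-homomorphism if $g\phi=g^{1-m}N$ for all $g\in M$, and $g\phi=hN$ implies $gM=hM$. An $m$-invariant quadruple for $G$ is a tuple $(L,M,N,\phi)$ with $L,M,N\trianglelefteq G$, $N\le M\le L$, $[G,L]\subseteq N$ (where $[G,L]=\{glg^{-1}l^{-1}\mid g\in G,l\in L\}$), and $\phi\colon L\to L/N$ an $(LMNm)$-homomorphism. For such a quadruple, $$\mathbf{K}_m(L,M,N,\phi)=\{(g_1,\dots,g_m)\in L^m\mid g_1M=\dots=g_mM,\ g_1\phi=g_1^{2-m}g_2g_3\cdots g_mN\}.$$ *)

theory Defs
  imports
    "HOL-Algebra.Coset"
    "HOL-Algebra.Product_Groups"
    "HOL-Combinatorics.Permutations"
begin

(* Elements of G^m are extensional functions on {1..m}. *)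
abbreviation power_group :: "('a, 'b) monoid_scheme \<Rightarrow> nat \<Rightarrow> (nat \<Rightarrow> 'a) monoid" where
  "power_group G m \<equiv> product_group {1..m} (\<lambda>_. G)"

definition perm_invariant :: "('a, 'b) monoid_scheme \<Rightarrow> nat \<Rightarrow> (nat \<Rightarrow> 'a) set \<Rightarrow> bool" where
  "perm_invariant G m K \<longleftrightarrow>
     (\<forall>\<sigma>. \<sigma> permutes {1..m} \<longrightarrow>
       (\<forall>x \<in> carrier (power_group G m). x \<in> K \<longleftrightarrow> (\<lambda>i\<in>{1..m}. x (\<sigma> i)) \<in> K))"

definition inv_normal_subgroup :: "('a, 'b) monoid_scheme \<Rightarrow> nat \<Rightarrow> (nat \<Rightarrow> 'a) set \<Rightarrow> bool" where
  "inv_normal_subgroup G m K \<longleftrightarrow> K \<lhd> power_group G m \<and> perm_invariant G m K"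

definition L_of :: "(nat \<Rightarrow> 'a) set \<Rightarrow> 'a set" where
  "L_of K = (\<lambda>x. x 1) ` K"

definition H_of :: "('a, 'b) monoid_scheme \<Rightarrow> nat \<Rightarrow> (nat \<Rightarrow> 'a) set \<Rightarrow> ('a \<times> 'a) set" where
  "H_of G m K = {(g, h). g \<in> carrier G \<and> h \<in> carrier G \<and>
     (\<lambda>i\<in>{1..m}. if i = 1 then g else if i = 2 then h else \<one>\<^bsub>G\<^esub>) \<in> K}"

definition M_of :: "('a, 'b) monoid_scheme \<Rightarrow> nat \<Rightarrow> (nat \<Rightarrow> 'a) set \<Rightarrow> 'a set" where
  "M_of G m K = fst ` H_of G m K"

definition N_of :: "('a, 'b) monoid_scheme \<Rightarrow> nat \<Rightarrow> (nat \<Rightarrow> 'a) set \<Rightarrow> 'a set" where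
  "N_of G m K = {n \<in> carrier G. (\<lambda>i\<in>{1..m}. if i = 1 then n else \<one>\<^bsub>G\<^esub>) \<in> K}"

(* Meaningful only for g in L_of K, with K an invariant normal subgroup and m >= 3: then such
   a y exists and its coset modulo N_of G m K does not depend on the choice of y. *)
definition phi_of :: "('a, 'b) monoid_scheme \<Rightarrow> nat \<Rightarrow> (nat \<Rightarrow> 'a) set \<Rightarrow> 'a \<Rightarrow> 'a set" where
  "phi_of G m K g =
     (THE C. \<exists>y \<in> carrier G. (\<lambda>i\<in>{1..m}. if i = 1 then y else g) \<in> K \<and> C = y <#\<^bsub>G\<^esub> N_of G m K)"

definition commutator_set :: "('a, 'b) monoid_scheme \<Rightarrow> 'a set \<Rightarrow> 'a set \<Rightarrow> 'a set" where
  "commutator_set G A B = {g \<otimes>\<^bsub>G\<^esub> l \<otimes>\<^bsub>G\<^esub> inv\<^bsub>G\<^esub> g \<otimes>\<^bsub>G\<^esub> inv\<^bsub>G\<^esub> l | g l. g \<in> A \<and> l \<in> B}"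

(* Only the values of phi on L matter. The elements of the quotient L/N are right cosets in the
   library; they coincide with the left cosets used here because N is normal. *)
definition LMNm_hom ::
  "('a, 'b) monoid_scheme \<Rightarrow> nat \<Rightarrow> 'a set \<Rightarrow> 'a set \<Rightarrow> 'a set \<Rightarrow> ('a \<Rightarrow> 'a set) \<Rightarrow> bool" where
  "LMNm_hom G m L M N \<phi> \<longleftrightarrow>
     \<phi> \<in> hom (G\<lparr>carrier := L\<rparr>) ((G\<lparr>carrier := L\<rparr>) Mod N) \<and>
     (\<forall>g\<in>M. \<phi> g = (g [^]\<^bsub>G\<^esub> (1 - int m)) <#\<^bsub>G\<^esub> N) \<and>
     (\<forall>g\<in>L. \<forall>h\<in>L. \<phi> g = h <#\<^bsub>G\<^esub> N \<longrightarrow> g <#\<^bsub>G\<^esub> M = h <#\<^bsub>G\<^esub> M)"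

definition invariant_quadruple ::
  "('a, 'b) monoid_scheme \<Rightarrow> nat \<Rightarrow> 'a set \<Rightarrow> 'a set \<Rightarrow> 'a set \<Rightarrow> ('a \<Rightarrow> 'a set) \<Rightarrow> bool" where
  "invariant_quadruple G m L M N \<phi> \<longleftrightarrow>
     L \<lhd> G \<and> M \<lhd> G \<and> N \<lhd> G \<and> N \<subseteq> M \<and> M \<subseteq> L \<and>
     commutator_set G (carrier G) L \<subseteq> N \<and> LMNm_hom G m L M N \<phi>"

(* The product of x 2, ..., x m is taken in this order, as G need not be commutative. *)
definition K_of ::
  "('a, 'b) monoid_scheme \<Rightarrow> nat \<Rightarrow> 'a set \<Rightarrow> 'a set \<Rightarrow> 'a set \<Rightarrow> ('a \<Rightarrow> 'a set) \<Rightarrow> (nat \<Rightarrow> 'a) set" where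
  "K_of G m L M N \<phi> =
     {x \<in> {1..m} \<rightarrow>\<^sub>E L.
        (\<forall>i\<in>{1..m}. \<forall>j\<in>{1..m}. x i <#\<^bsub>G\<^esub> M = x j <#\<^bsub>G\<^esub> M) \<and>
        \<phi> (x 1) = (x 1 [^]\<^bsub>G\<^esub> (2 - int m)
                     \<otimes>\<^bsub>G\<^esub> foldr (\<otimes>\<^bsub>G\<^esub>) (map x [2..<Suc m]) \<one>\<^bsub>G\<^esub>) <#\<^bsub>G\<^esub> N}"

end

theory Submission
  imports Defs "HOL-Algebra.FiniteProduct"
begin

text \<open>
  Since \<open>[G, L] \<subseteq> N\<close>, the quotient \<open>L/N\<close> is central in \<open>G/N\<close>; in particular it is abelian and
  conjugation in \<open>G\<close> is invisible in it. This makes the condition defining \<open>K_of\<close> symmetric in the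
  coordinates: multiplying it by \<open>x\<^sub>1\<close> to the power \<open>m - 1\<close> turns it into
  \<open>\<psi> x\<^sub>1 = x\<^sub>1 x\<^sub>2 \<dots> x\<^sub>m N\<close>, where \<open>\<psi> g\<close> is \<open>\<phi> g\<close> times the coset of \<open>g\<close> to the power \<open>m - 1\<close>.
  The map \<open>\<psi>\<close> is a homomorphism from \<open>L\<close> to \<open>L/N\<close>, and the formula for \<open>\<phi>\<close> on \<open>M\<close> says exactly that
  \<open>\<psi>\<close> kills \<open>M\<close>. As the coordinates of \<open>x\<close> agree modulo \<open>M\<close>, all \<open>\<psi> x\<^sub>i\<close> are equal, so the
  condition (\<open>mem_K_iff\<close>) is stable under permutations, products, inverses and conjugation. The
  invariants of the resulting subgroup can then be read off from tuples of the shape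
  \<open>(y, g, \<dots>, g)\<close>, which belong to it precisely when \<open>\<phi> g = y N\<close>
  (\<open>almost_constant_mem_K_iff\<close>).

  Conversely, let \<open>K\<close> be an invariant normal subgroup. Conjugating \<open>x \<in> K\<close> in a single coordinate and
  dividing by \<open>x\<close> gives \<open>[G, L] \<subseteq> N\<close>; swapping two coordinates of \<open>x\<close> and dividing shows that all
  coordinates of \<open>x\<close> agree modulo \<open>M\<close> (\<open>K_cong\<close>). For \<open>a \<in> M\<close> the group \<open>K\<close> contains every tuple with
  entries \<open>a\<close> and \<open>a\<inverse>\<close> at two places and \<open>1\<close> elsewhere; a third place, available because
  \<open>m \<ge> 3\<close>, is needed to see this (\<open>two_point_inverse_mem_K\<close>). Products of such tuples, corrected by an element of \<open>N\<close> at the first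
  place, exhaust the elements of \<open>M\<^sup>m\<close> whose product lies in \<open>N\<close> (\<open>MK_power_mem_K\<close>). Hence, for tuples
  over \<open>L\<close> that agree modulo \<open>M\<close> place by place, membership in \<open>K\<close> depends only on the product
  modulo \<open>N\<close> (\<open>K_transfer\<close>). So every \<open>x \<in> K\<close> may be replaced by a tuple
  \<open>(y, x\<^sub>1, \<dots>, x\<^sub>1)\<close> in \<open>K\<close> with the same product, which gives the existence of \<open>\<phi>\<^sub>K\<close>, its
  defining properties, and the equality of \<open>K\<close> with the subgroup built from its quadruple.
\<close>

(* The infix symbol of left cosets is also that of strict submultisets; only the former is meant. *)
no_notation subset_mset (infix \<open><#\<close> 50)

section \<open>Products in a central section of a group\<close>

lemma (in normal) l_coset_mult:
  assumes "x \<in> carrier G" "y \<in> carrier G"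
  shows "(x \<otimes> y) <# H = (x <# H) <#> (y <# H)"
  using assms by (simp add: rcos_sum flip: coset_eq[rule_format])

lemma (in normal) l_coset_inv:
  assumes "x \<in> carrier G"
  shows "inv x <# H = set_inv (x <# H)"
  using assms by (simp add: rcos_inv flip: coset_eq[rule_format])

lemma (in normal) l_coset_eq_iff:
  assumes x: "x \<in> carrier G" and y: "y \<in> carrier G"
  shows "x <# H = y <# H \<longleftrightarrow> x \<otimes> inv y \<in> H"
proof -
  have "H #> x = H #> y \<longleftrightarrow> x \<in> H #> y"
    using repr_independence[OF _ y subgroup_axioms] repr_independenceD[OF subgroup_axioms x] by metis
  also have "\<dots> \<longleftrightarrow> x \<otimes> inv y \<in> H"
    using rcos_module[OF is_group y x] .
  finally show ?thesis using x y by (simp flip: coset_eq[rule_format])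
qed

text \<open>
  The hypotheses make \<open>L/N\<close> a central subgroup of \<open>G/N\<close>. Both directions take place here: the
  quadruple attached to an invariant normal subgroup satisfies the hypotheses before anything is known
  about its homomorphism.
\<close>
locale central_section = group G for G (structure) +
  fixes L N :: "'a set"
  assumes L_normal: "L \<lhd> G" and N_normal: "N \<lhd> G" and N_le_L: "N \<subseteq> L"
    and central: "commutator_set G (carrier G) L \<subseteq> N"
begin

sublocale L: normal L G by (rule L_normal)
sublocale N: normal N G by (rule N_normal)

lemma restrict_group [simp]: "group (G\<lparr>carrier := L\<rparr>)"
  by (rule L.subgroup_is_group[OF is_group])

text \<open>
  The quotient \<open>L/N\<close>. It is a constant of its own so that its product stays the operation of an
  abelian group; the simplifier would otherwise rewrite it to a product of sets.
\<close>
definition Q :: "'a set monoid" where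
  "Q = (G\<lparr>carrier := L\<rparr>) Mod N"

lemma mult_Q: "X \<otimes>\<^bsub>Q\<^esub> Y = X <#> Y"
  by (simp add: Q_def set_mult_def)

lemma one_Q: "\<one>\<^bsub>Q\<^esub> = N"
  by (simp add: Q_def)

lemma carrier_Q: "carrier Q = (\<lambda>x. x <# N) ` L"
  using L.subset by (auto simp: Q_def carrier_FactGroup r_coset_def N.coset_eq[rule_format, symmetric])

lemma commutator_mem:
  assumes "g \<in> carrier G" "l \<in> L"
  shows "g \<otimes> l \<otimes> inv g \<otimes> inv l \<in> N"
  using central assms by (auto simp: commutator_set_def)

text \<open>
  Centrality of \<open>L/N\<close> passes to every larger normal subgroup in the place of \<open>N\<close>.
\<close>
lemma conj_coset:
  assumes "H \<lhd> G" "N \<subseteq> H" "g \<in> carrier G" "l \<in> L"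
  shows "(g \<otimes> l \<otimes> inv g) <# H = l <# H"
  using normal.l_coset_eq_iff[OF assms(1), of "g \<otimes> l \<otimes> inv g" l] assms commutator_mem[of g l]
  by auto

sublocale Q: comm_group Q
proof (rule group.group_comm_groupI)
  show "group Q"
    unfolding Q_def
    by (intro normal.factorgroup_is_group normal_restrict_supergroup L.subgroup_axioms
              N_normal N_le_L)
next
  fix X Y assume "X \<in> carrier Q" "Y \<in> carrier Q"
  then obtain x y where xy: "x \<in> L" "X = x <# N" "y \<in> L" "Y = y <# N"
    by (auto simp: carrier_Q)
  have "x \<otimes> y <# N = y \<otimes> x <# N"
    using commutator_mem[of x y] xy by (subst N.l_coset_eq_iff) (auto simp: inv_mult_group m_assoc)
  then show "X \<otimes>\<^bsub>Q\<^esub> Y = Y \<otimes>\<^bsub>Q\<^esub> X"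
    using xy by (simp add: mult_Q N.l_coset_mult)
qed

lemma coset_closed [simp]: "x \<in> L \<Longrightarrow> x <# N \<in> carrier Q"
  by (simp add: carrier_Q)

lemma coset_mult: "x \<in> L \<Longrightarrow> y \<in> L \<Longrightarrow> (x \<otimes> y) <# N = (x <# N) \<otimes>\<^bsub>Q\<^esub> (y <# N)"
  by (simp add: mult_Q N.l_coset_mult)

lemma coset_one: "\<one> <# N = \<one>\<^bsub>Q\<^esub>"
  by (simp add: one_Q coset_join3 N.subgroup_axioms)

lemma coset_hom: "group_hom (G\<lparr>carrier := L\<rparr>) Q (\<lambda>x. x <# N)"
  by (simp add: group_hom_def group_hom_axioms_def hom_def coset_mult)

lemma coset_inv: "x \<in> L \<Longrightarrow> inv x <# N = inv\<^bsub>Q\<^esub> (x <# N)"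
  using group_hom.hom_inv[OF coset_hom, of x] by (simp add: L.subgroup_axioms)

lemma coset_int_pow: "x \<in> L \<Longrightarrow> (x [^] (k::int)) <# N = (x <# N) [^]\<^bsub>Q\<^esub> k"
  using group_hom.hom_int_pow[OF coset_hom, of x k]
  by (simp add: int_pow_consistent[OF L.subgroup_axioms])

lemma coset_eq_one_iff: "x \<in> L \<Longrightarrow> x <# N = \<one>\<^bsub>Q\<^esub> \<longleftrightarrow> x \<in> N"
  using N.l_coset_eq_iff[of x \<one>] by (simp add: coset_one)

text \<open>
  The class of the product of all coordinates in the abelian group \<open>L/N\<close>, where the order of the
  factors is immaterial.
\<close>
definition coset_prod :: "nat \<Rightarrow> (nat \<Rightarrow> 'a) \<Rightarrow> 'a set" where
  "coset_prod m x = finprod Q (\<lambda>i. x i <# N) {1..m}"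

lemma coset_prod_closed [simp]: "x \<in> {1..m} \<rightarrow> L \<Longrightarrow> coset_prod m x \<in> carrier Q"
  by (auto simp: coset_prod_def Pi_iff intro!: Q.finprod_closed)

lemma coset_prod_cong:
  "y \<in> {1..m} \<rightarrow> L \<Longrightarrow> (\<And>i. i \<in> {1..m} \<Longrightarrow> x i <# N = y i <# N) \<Longrightarrow> coset_prod m x = coset_prod m y"
  unfolding coset_prod_def by (rule Q.finprod_cong') (auto simp: Pi_iff)

lemma coset_prod_mult:
  assumes "x \<in> {1..m} \<rightarrow> L" "y \<in> {1..m} \<rightarrow> L"
  shows "coset_prod m (\<lambda>i\<in>{1..m}. x i \<otimes> y i) = coset_prod m x \<otimes>\<^bsub>Q\<^esub> coset_prod m y"
proof -
  have "coset_prod m (\<lambda>i\<in>{1..m}. x i \<otimes> y i) = finprod Q (\<lambda>i. (x i <# N) \<otimes>\<^bsub>Q\<^esub> (y i <# N)) {1..m}"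
    unfolding coset_prod_def using assms by (intro Q.finprod_cong') (auto simp: coset_mult Pi_iff)
  also have "\<dots> = coset_prod m x \<otimes>\<^bsub>Q\<^esub> coset_prod m y"
    unfolding coset_prod_def using assms by (intro Q.finprod_multf) (auto simp: Pi_iff)
  finally show ?thesis .
qed

lemma coset_prod_inv:
  assumes "x \<in> {1..m} \<rightarrow> L"
  shows "coset_prod m (\<lambda>i\<in>{1..m}. inv (x i)) = inv\<^bsub>Q\<^esub> coset_prod m x"
proof (rule Q.inv_equality[symmetric])
  have inv: "(\<lambda>i\<in>{1..m}. inv (x i)) \<in> {1..m} \<rightarrow> L" using assms by auto
  then have "coset_prod m (\<lambda>i\<in>{1..m}. inv (x i)) \<otimes>\<^bsub>Q\<^esub> coset_prod m x =
    coset_prod m (\<lambda>i\<in>{1..m}. (\<lambda>i\<in>{1..m}. inv (x i)) i \<otimes> x i)"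
    using coset_prod_mult assms by metis
  also have "\<dots> = \<one>\<^bsub>Q\<^esub>"
    unfolding coset_prod_def using assms
    by (intro Q.finprod_one_eqI) (auto simp: Pi_iff coset_one)
  finally show "coset_prod m (\<lambda>i\<in>{1..m}. inv (x i)) \<otimes>\<^bsub>Q\<^esub> coset_prod m x = \<one>\<^bsub>Q\<^esub>" .
  show "coset_prod m x \<in> carrier Q" "coset_prod m (\<lambda>i\<in>{1..m}. inv (x i)) \<in> carrier Q"
    using assms inv by simp_all
qed

lemma coset_prod_permute:
  assumes "\<sigma> permutes {1..m}" "x \<in> {1..m} \<rightarrow> L"
  shows "coset_prod m (\<lambda>i\<in>{1..m}. x (\<sigma> i)) = coset_prod m x"
proof -
  have \<sigma>x: "x (\<sigma> i) \<in> L" if "i \<in> {1..m}" for i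
    using that assms(2) permutes_in_image[OF assms(1), of i] by blast
  have inj: "inj_on \<sigma> {1..m}" using permutes_inj_on[OF assms(1)] .
  have "coset_prod m (\<lambda>i\<in>{1..m}. x (\<sigma> i)) = finprod Q (\<lambda>i. x (\<sigma> i) <# N) {1..m}"
    unfolding coset_prod_def using \<sigma>x by (intro Q.finprod_cong') (auto simp: Pi_iff)
  also have "\<dots> = finprod Q (\<lambda>i. x i <# N) (\<sigma> ` {1..m})"
    using assms(2) by (intro Q.finprod_reindex[symmetric] inj) (use \<sigma>x in auto)
  finally show ?thesis unfolding coset_prod_def permutes_image[OF assms(1)] .
qed

lemma coset_prod_pair:
  assumes ij: "i \<in> {1..m}" "j \<in> {1..m}" "i \<noteq> j" and x: "x \<in> {1..m} \<rightarrow> L"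
    and one: "\<And>k. k \<in> {1..m} \<Longrightarrow> k \<noteq> i \<Longrightarrow> k \<noteq> j \<Longrightarrow> x k = \<one>"
  shows "coset_prod m x = (x i <# N) \<otimes>\<^bsub>Q\<^esub> (x j <# N)"
proof -
  have xL: "x i \<in> L" "x j \<in> L" using x ij by blast+
  have "coset_prod m x = finprod Q (\<lambda>k. x k <# N) {i, j}"
    unfolding coset_prod_def using ij x one
    by (intro Q.finprod_mono_neutral_cong_right) (auto simp: coset_one Pi_iff)
  then show ?thesis using xL ij(3) by simp
qed

lemma coset_prod_head:
  assumes "1 \<le> m" "x \<in> {1..m} \<rightarrow> L"
  shows "coset_prod m x = (x 1 <# N) \<otimes>\<^bsub>Q\<^esub> finprod Q (\<lambda>i. x i <# N) {2..m}"
proof -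
  have "{1..m} = insert 1 {2..m}" using assms(1) by auto
  then show ?thesis
    unfolding coset_prod_def using assms by (subst Q.finprod_insert[symmetric]) (auto simp: Pi_iff)
qed

lemma coset_prod_almost_constant:
  assumes "1 \<le> m" "y \<in> L" "g \<in> L"
  shows "coset_prod m (\<lambda>i\<in>{1..m}. if i = 1 then y else g)
    = (y <# N) \<otimes>\<^bsub>Q\<^esub> ((g <# N) [^]\<^bsub>Q\<^esub> (int m - 1))"
proof -
  let ?x = "\<lambda>i\<in>{1..m}. if i = 1 then y else g"
  have "finprod Q (\<lambda>i. ?x i <# N) {2..m} = finprod Q (\<lambda>i. g <# N) {2..m}"
    using assms by (intro Q.finprod_cong') auto
  also have "\<dots> = (g <# N) [^]\<^bsub>Q\<^esub> (m - 1)"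
    using assms by (subst Q.finprod_const) auto
  also have "\<dots> = (g <# N) [^]\<^bsub>Q\<^esub> (int m - 1)"
    using assms(1) int_pow_int[of Q "g <# N" "m - 1"] by (simp add: of_nat_diff)
  finally show ?thesis
    using coset_prod_head[of m ?x] assms by auto
qed

text \<open>
  This lets the ordered product in \<open>K_of\<close> be handled by the unordered product of \<open>L/N\<close>.
\<close>
lemma foldr_mult_closed_coset:
  assumes "distinct is" "x \<in> set is \<rightarrow> L"
  shows "foldr (\<otimes>) (map x is) \<one> \<in> L \<and>
    foldr (\<otimes>) (map x is) \<one> <# N = finprod Q (\<lambda>i. x i <# N) (set is)"
  using assms
proof (induction "is")
  case Nil
  then show ?case by (simp add: coset_one)
next
  case (Cons i "is")
  then have IH: "foldr (\<otimes>) (map x is) \<one> \<in> L"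
     "foldr (\<otimes>) (map x is) \<one> <# N = finprod Q (\<lambda>i. x i <# N) (set is)"
    by auto
  have "x i \<in> L" using Cons.prems by auto
  moreover have "finprod Q (\<lambda>i. x i <# N) (set (i # is))
     = (x i <# N) \<otimes>\<^bsub>Q\<^esub> finprod Q (\<lambda>i. x i <# N) (set is)"
    using Cons.prems by (simp, subst Q.finprod_insert) (auto simp: Pi_iff)
  ultimately show ?case using IH by (simp add: coset_mult)
qed

lemma coset_of_defining_word:
  assumes "1 \<le> m" "x \<in> {1..m} \<rightarrow> L"
  shows "(x 1 [^] (2 - int m) \<otimes> foldr (\<otimes>) (map x [2..<Suc m]) \<one>) <# N
    = ((x 1 <# N) [^]\<^bsub>Q\<^esub> (1 - int m)) \<otimes>\<^bsub>Q\<^esub> coset_prod m x"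
proof -
  have x1: "x 1 \<in> L" using assms by auto
  have set: "set [2..<Suc m] = {2..m}" by auto
  let ?R = "finprod Q (\<lambda>i. x i <# N) {2..m}"
  have R: "?R \<in> carrier Q" using assms by (intro Q.finprod_closed) (auto simp: Pi_iff)
  have w: "foldr (\<otimes>) (map x [2..<Suc m]) \<one> \<in> L"
    "foldr (\<otimes>) (map x [2..<Suc m]) \<one> <# N = ?R"
    using foldr_mult_closed_coset[of "[2..<Suc m]" x] assms(2) unfolding set
    by (auto simp: Pi_iff simp del: upt_Suc)
  have "(x 1 [^] (2 - int m) \<otimes> foldr (\<otimes>) (map x [2..<Suc m]) \<one>) <# N
     = ((x 1 <# N) [^]\<^bsub>Q\<^esub> (2 - int m)) \<otimes>\<^bsub>Q\<^esub> ?R"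
    using w x1 by (simp only: coset_mult subgroup_int_pow_closed[OF L.subgroup_axioms] coset_int_pow)
  also have "(x 1 <# N) [^]\<^bsub>Q\<^esub> (2 - int m) = (x 1 <# N) [^]\<^bsub>Q\<^esub> (1 - int m) \<otimes>\<^bsub>Q\<^esub> (x 1 <# N)"
    using Q.int_pow_mult[of "x 1 <# N" "1 - int m" 1] x1 by (simp add: algebra_simps)
  finally show ?thesis
    using coset_prod_head[OF assms] R x1 by (simp add: Q.m_assoc)
qed

text \<open>
  The symmetric form of the equation in \<open>K_of\<close>: multiplying both sides by the coset of
  \<open>x 1\<close> to the power \<open>m - 1\<close> cancels the exponent \<open>2 - m\<close> up to one factor \<open>x 1\<close>, which completes the
  product of the other coordinates.
\<close>
lemma defining_equation_iff:
  assumes m: "1 \<le> m" and x: "x \<in> {1..m} \<rightarrow> L" and X: "X \<in> carrier Q"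
  shows "X = (x 1 [^] (2 - int m) \<otimes> foldr (\<otimes>) (map x [2..<Suc m]) \<one>) <# N
    \<longleftrightarrow> X \<otimes>\<^bsub>Q\<^esub> ((x 1 <# N) [^]\<^bsub>Q\<^esub> (int m - 1)) = coset_prod m x"
proof -
  have x1: "x 1 \<in> L" using x m by auto
  let ?q = "x 1 <# N" and ?p = "coset_prod m x"
  have q: "?q \<in> carrier Q" and p: "?p \<in> carrier Q" using x1 x by simp_all
  have "X = (?q [^]\<^bsub>Q\<^esub> (1 - int m)) \<otimes>\<^bsub>Q\<^esub> ?p
     \<longleftrightarrow> X = ?p \<otimes>\<^bsub>Q\<^esub> inv\<^bsub>Q\<^esub> (?q [^]\<^bsub>Q\<^esub> (int m - 1))"
    using q p Q.int_pow_neg[OF q, of "int m - 1"] by (simp add: Q.m_comm)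
  also have "\<dots> \<longleftrightarrow> X \<otimes>\<^bsub>Q\<^esub> (?q [^]\<^bsub>Q\<^esub> (int m - 1)) = ?p"
    using q p X Q.inv_solve_right[of X ?p "?q [^]\<^bsub>Q\<^esub> (int m - 1)"] by auto
  finally show ?thesis
    using coset_of_defining_word[OF m x] by simp
qed

end
section \<open>The subgroup of an invariant quadruple\<close>

lemma mem_M_of_iff:
  "g \<in> M_of G m K \<longleftrightarrow> g \<in> carrier G \<and> (\<exists>h\<in>carrier G.
     (\<lambda>i\<in>{1..m}. if i = 1 then g else if i = 2 then h else \<one>\<^bsub>G\<^esub>) \<in> K)"
  unfolding M_of_def H_of_def image_iff
  by (simp only: Bex_def mem_Collect_eq split_paired_Ex prod.case fst_conv) blast

locale invariant_quad = group G for G (structure) +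
  fixes m :: nat and L M N :: "'a set" and \<phi> :: "'a \<Rightarrow> 'a set"
  assumes m_ge_3: "3 \<le> m" and quad: "invariant_quadruple G m L M N \<phi>"
begin

sublocale central_section G L N
  using quad by (unfold_locales) (auto simp: invariant_quadruple_def normal_def normal_axioms_def
      subgroup_def)

lemma M_normal: "M \<lhd> G" and N_le_M: "N \<subseteq> M" and M_le_L: "M \<subseteq> L"
  using quad by (auto simp: invariant_quadruple_def)

sublocale M: normal M G by (rule M_normal)

lemma phi_hom: "\<phi> \<in> hom (G\<lparr>carrier := L\<rparr>) Q"
  using quad by (simp add: invariant_quadruple_def LMNm_hom_def Q_def)

lemma phi_closed [simp]: "g \<in> L \<Longrightarrow> \<phi> g \<in> carrier Q"
  using hom_in_carrier[OF phi_hom] by simp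

lemma phi_M: "g \<in> M \<Longrightarrow> \<phi> g = (g [^] (1 - int m)) <# N"
  using quad by (simp add: invariant_quadruple_def LMNm_hom_def)

lemma phi_cong: "g \<in> L \<Longrightarrow> h \<in> L \<Longrightarrow> \<phi> g = h <# N \<Longrightarrow> g <# M = h <# M"
  using quad by (simp add: invariant_quadruple_def LMNm_hom_def)

text \<open>
  The left-hand side of the symmetric form of the defining equation, as a function of \<open>x 1\<close>.
\<close>
definition \<psi> :: "'a \<Rightarrow> 'a set" where
  "\<psi> g = \<phi> g \<otimes>\<^bsub>Q\<^esub> ((g <# N) [^]\<^bsub>Q\<^esub> (int m - 1))"

lemma psi_closed [simp]: "g \<in> L \<Longrightarrow> \<psi> g \<in> carrier Q"
  by (simp add: \<psi>_def)

lemma psi_mult: "g \<in> L \<Longrightarrow> h \<in> L \<Longrightarrow> \<psi> (g \<otimes> h) = \<psi> g \<otimes>\<^bsub>Q\<^esub> \<psi> h"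
  using hom_mult[OF phi_hom, of g h]
  by (simp add: \<psi>_def coset_mult Q.int_pow_mult_distrib Q.m_comm Q.m_ac)

text \<open>
  The prescribed values \<open>\<phi> g = g [^] (1 - m) N\<close> on \<open>M\<close> are exactly what makes \<open>\<psi>\<close> trivial there.
\<close>
lemma psi_M: "g \<in> M \<Longrightarrow> \<psi> g = \<one>\<^bsub>Q\<^esub>"
  using M_le_L Q.int_pow_mult[of "g <# N" "1 - int m" "int m - 1", symmetric]
  by (auto simp: \<psi>_def phi_M coset_int_pow)

lemma psi_inv: "g \<in> L \<Longrightarrow> \<psi> (inv g) = inv\<^bsub>Q\<^esub> \<psi> g"
  using psi_mult[of "inv g" g] psi_M[of \<one>] by (intro Q.inv_equality[symmetric]) auto

text \<open>
  Since \<open>\<psi>\<close> kills \<open>M\<close>, the first coordinate in \<open>\<psi> (x 1)\<close> may be replaced by any other coordinate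
  of a tuple in \<open>K\<close>.
\<close>
lemma psi_cong:
  assumes "g \<in> L" "h \<in> L" "g <# M = h <# M"
  shows "\<psi> g = \<psi> h"
proof -
  have "g \<otimes> inv h \<in> M"
    using assms M.l_coset_eq_iff[of g h] by auto
  then have "\<psi> g \<otimes>\<^bsub>Q\<^esub> inv\<^bsub>Q\<^esub> \<psi> h = \<one>\<^bsub>Q\<^esub>"
    using assms psi_mult[of g "inv h"] psi_M by (auto simp: psi_inv)
  then show ?thesis
    using assms Q.inv_solve_right'[of "\<one>\<^bsub>Q\<^esub>" "\<psi> g" "\<psi> h"] by simp
qed

abbreviation K where "K \<equiv> K_of G m L M N \<phi>"

lemma mem_K_iff:
  "x \<in> K \<longleftrightarrow> x \<in> {1..m} \<rightarrow>\<^sub>E L \<and> (\<forall>i\<in>{1..m}. \<forall>j\<in>{1..m}. x i <# M = x j <# M)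
      \<and> \<psi> (x 1) = coset_prod m x"
proof -
  have "\<phi> (x 1) = (x 1 [^] (2 - int m) \<otimes> foldr (\<otimes>) (map x [2..<Suc m]) \<one>) <# N
     \<longleftrightarrow> \<psi> (x 1) = coset_prod m x" if x: "x \<in> {1..m} \<rightarrow>\<^sub>E L"
    unfolding \<psi>_def using x m_ge_3 PiE_mem[OF x, of 1]
    by (intro defining_equation_iff) (auto simp: PiE_def)
  then show ?thesis unfolding K_of_def by auto
qed

lemma restrict_mem_K_iff:
  "(\<lambda>i\<in>{1..m}. f i) \<in> K \<longleftrightarrow> (\<forall>i\<in>{1..m}. f i \<in> L)
      \<and> (\<forall>i\<in>{1..m}. \<forall>j\<in>{1..m}. f i <# M = f j <# M)
      \<and> \<psi> (f 1) = coset_prod m (\<lambda>i\<in>{1..m}. f i)"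
proof -
  have "(1::nat) \<in> {1..m}" using m_ge_3 by simp
  then show ?thesis unfolding mem_K_iff restrict_PiE_iff by (simp only: restrict_apply' cong: ball_cong)
qed

lemma K_D:
  assumes "x \<in> K"
  shows "\<And>i. i \<in> {1..m} \<Longrightarrow> x i \<in> L"
    and "\<And>i j. i \<in> {1..m} \<Longrightarrow> j \<in> {1..m} \<Longrightarrow> x i <# M = x j <# M"
    and "\<psi> (x 1) = coset_prod m x"
  using assms unfolding mem_K_iff by blast+

lemma K_subset: "x \<in> K \<Longrightarrow> x \<in> {1..m} \<rightarrow>\<^sub>E L"
  by (simp add: mem_K_iff)

text \<open>
  Both sides of the equation in \<open>mem_K_iff\<close> are multiplicative in \<open>x\<close>. Conjugation changes none of the
  cosets of \<open>N\<close> and \<open>M\<close> that occur there, and permutations are covered by \<open>psi_cong\<close>.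
\<close>
lemma K_inv_normal: "inv_normal_subgroup G m K"
  unfolding inv_normal_subgroup_def
proof
  interpret P: group "power_group G m" by (simp add: is_group)
  have LG: "x \<in> {1..m} \<rightarrow>\<^sub>E carrier G" if "x \<in> {1..m} \<rightarrow>\<^sub>E L" for x
    using that by (auto simp: PiE_iff)
  have one_in: "1 \<in> {1..m}" using m_ge_3 by simp
  show "K \<lhd> power_group G m"
  proof (rule P.normal_invI)
    show "subgroup K (power_group G m)"
    proof (rule P.subgroupI)
      show "K \<subseteq> carrier (power_group G m)" using LG K_subset by auto
      have "(\<lambda>i\<in>{1..m}. \<one>) \<in> K"
        using one_in unfolding mem_K_iff
        by (auto simp: psi_M coset_prod_def coset_one intro!: Q.finprod_one_eqI[symmetric])
      then show "K \<noteq> {}" by blast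
    next
      fix x assume x: "x \<in> K"
      then have "inv\<^bsub>power_group G m\<^esub> x = (\<lambda>i\<in>{1..m}. inv (x i))"
        using LG[OF K_subset] by (simp add: is_group)
      moreover have "(\<lambda>i\<in>{1..m}. inv (x i)) \<in> K"
        unfolding restrict_mem_K_iff
      proof (intro conjI ballI)
        fix i j assume ij: "i \<in> {1..m}" "j \<in> {1..m}"
        show "inv x i \<in> L" using K_D(1)[OF x ij(1)] by simp
        show "inv x i <# M = inv x j <# M"
          using K_D(1)[OF x] K_D(2)[OF x ij] ij by (simp add: M.l_coset_inv)
      next
        show "\<psi> (inv x 1) = coset_prod m (\<lambda>i\<in>{1..m}. inv x i)"
          using K_D(3)[OF x] K_D(1)[OF x] one_in by (subst coset_prod_inv) (simp_all add: psi_inv)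
      qed
      ultimately show "inv\<^bsub>power_group G m\<^esub> x \<in> K" by simp
    next
      fix x y assume x: "x \<in> K" and y: "y \<in> K"
      have "(\<lambda>i\<in>{1..m}. x i \<otimes> y i) \<in> K"
        unfolding restrict_mem_K_iff
      proof (intro conjI ballI)
        fix i j assume ij: "i \<in> {1..m}" "j \<in> {1..m}"
        show "x i \<otimes> y i \<in> L" using K_D(1)[OF x ij(1)] K_D(1)[OF y ij(1)] by simp
        show "(x i \<otimes> y i) <# M = (x j \<otimes> y j) <# M"
          using K_D(1)[OF x] K_D(2)[OF x ij] K_D(1)[OF y] K_D(2)[OF y ij] ij
          by (simp add: M.l_coset_mult)
      next
        show "\<psi> (x 1 \<otimes> y 1) = coset_prod m (\<lambda>i\<in>{1..m}. x i \<otimes> y i)"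
          using K_D(3)[OF x] K_D(1)[OF x] K_D(3)[OF y] K_D(1)[OF y] one_in
          by (subst coset_prod_mult) (simp_all add: psi_mult)
      qed
      then show "x \<otimes>\<^bsub>power_group G m\<^esub> y \<in> K" by simp
    qed
  next
    fix g x assume g: "g \<in> carrier (power_group G m)" and x: "x \<in> K"
    let ?y = "\<lambda>i\<in>{1..m}. g i \<otimes> x i \<otimes> inv (g i)"
    have mem: "g i \<in> carrier G" "x i \<in> L" if "i \<in> {1..m}" for i
      using g K_D(1)[OF x] that by (auto simp: PiE_iff)
    then have yL: "g i \<otimes> x i \<otimes> inv (g i) \<in> L" if "i \<in> {1..m}" for i
      using that by (simp add: L.inv_op_closed2)
    have c: "?y i <# M = x i <# M" "?y i <# N = x i <# N" if "i \<in> {1..m}" for i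
      using that mem[OF that] conj_coset[OF M_normal N_le_M] conj_coset[OF N_normal] by simp_all
    have "coset_prod m ?y = coset_prod m x"
      using c K_D(1)[OF x] by (intro coset_prod_cong) auto
    moreover have "\<psi> (g 1 \<otimes> x 1 \<otimes> inv (g 1)) = \<psi> (x 1)"
      using c(1)[OF one_in] yL[OF one_in] mem[OF one_in] one_in by (intro psi_cong) auto
    ultimately have "?y \<in> K"
      unfolding restrict_mem_K_iff
    proof (intro conjI ballI)
      fix i j assume ij: "i \<in> {1..m}" "j \<in> {1..m}"
      show "g i \<otimes> x i \<otimes> inv g i \<in> L" by (rule yL[OF ij(1)])
      have "(g i \<otimes> x i \<otimes> inv (g i)) <# M = x i <# M" "(g j \<otimes> x j \<otimes> inv (g j)) <# M = x j <# M"
        using c(1)[OF ij(1)] c(1)[OF ij(2)] ij by simp_all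
      then show "(g i \<otimes> x i \<otimes> inv g i) <# M = (g j \<otimes> x j \<otimes> inv g j) <# M"
        using K_D(2)[OF x ij] by simp
    qed (use K_D(3)[OF x] in simp)
    moreover have "g \<otimes>\<^bsub>power_group G m\<^esub> x \<otimes>\<^bsub>power_group G m\<^esub> inv\<^bsub>power_group G m\<^esub> g = ?y"
      using g by (auto simp: is_group)
    ultimately show "g \<otimes>\<^bsub>power_group G m\<^esub> x \<otimes>\<^bsub>power_group G m\<^esub> inv\<^bsub>power_group G m\<^esub> g \<in> K"
      by simp
  qed
  have perm: "(\<lambda>i\<in>{1..m}. x (\<sigma> i)) \<in> K" if \<sigma>: "\<sigma> permutes {1..m}" and x: "x \<in> K" for \<sigma> x
  proof -
    have \<sigma>in: "\<sigma> i \<in> {1..m}" if "i \<in> {1..m}" for i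
      using that permutes_in_image[OF \<sigma>] by blast
    have "\<psi> (x (\<sigma> 1)) = \<psi> (x 1)"
      using \<sigma>in[OF one_in] one_in by (intro psi_cong K_D(1,2)[OF x])
    moreover have "coset_prod m (\<lambda>i\<in>{1..m}. x (\<sigma> i)) = coset_prod m x"
      by (rule coset_prod_permute[OF \<sigma>]) (use K_D(1)[OF x] in blast)
    ultimately show ?thesis
      unfolding restrict_mem_K_iff
    proof (intro conjI ballI)
      fix i j assume ij: "i \<in> {1..m}" "j \<in> {1..m}"
      show "x (\<sigma> i) \<in> L" by (rule K_D(1)[OF x \<sigma>in[OF ij(1)]])
      show "x (\<sigma> i) <# M = x (\<sigma> j) <# M" by (rule K_D(2)[OF x \<sigma>in[OF ij(1)] \<sigma>in[OF ij(2)]])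
    qed (use K_D(3)[OF x] in simp)
  qed
  show "perm_invariant G m K"
    unfolding perm_invariant_def
  proof (intro allI impI ballI iffI)
    fix \<sigma> :: "nat \<Rightarrow> nat" and x
    assume \<sigma>: "\<sigma> permutes {1..m}" and x: "x \<in> carrier (power_group G m)"
    { assume "x \<in> K" then show "(\<lambda>i\<in>{1..m}. x (\<sigma> i)) \<in> K" by (rule perm[OF \<sigma>]) }
    { assume "(\<lambda>i\<in>{1..m}. x (\<sigma> i)) \<in> K"
      then have "(\<lambda>i\<in>{1..m}. (\<lambda>i\<in>{1..m}. x (\<sigma> i)) (inv_into UNIV \<sigma> i)) \<in> K"
        by (rule perm[OF permutes_inv[OF \<sigma>]])
      also have "(\<lambda>i\<in>{1..m}. (\<lambda>i\<in>{1..m}. x (\<sigma> i)) (inv_into UNIV \<sigma> i)) = x"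
      proof
        fix i
        show "(\<lambda>i\<in>{1..m}. (\<lambda>i\<in>{1..m}. x (\<sigma> i)) (inv_into UNIV \<sigma> i)) i = x i"
          using x permutes_in_image[OF permutes_inv[OF \<sigma>], of i] permutes_inverses(1)[OF \<sigma>, of i]
          by (auto simp: PiE_iff extensional_def)
      qed
      finally show "x \<in> K" . }
  qed
qed

text \<open>
  For \<open>(y, g, \<dots>, g)\<close> the power of \<open>g\<close> in \<open>\<psi> g\<close> cancels against the last \<open>m - 1\<close> coordinates. The
  congruence of \<open>y\<close> and \<open>g\<close> modulo \<open>M\<close> then comes for free, since \<open>\<phi> g = y N\<close> forces it in a
  quadruple.
\<close>
lemma almost_constant_mem_K_iff:
  assumes "y \<in> carrier G" "g \<in> L"
  shows "(\<lambda>i\<in>{1..m}. if i = 1 then y else g) \<in> K \<longleftrightarrow> y \<in> L \<and> \<phi> g = y <# N"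
proof (cases "y \<in> L")
  case True
  let ?x = "\<lambda>i\<in>{1..m}. if i = 1 then y else g"
  have *: "\<psi> g = coset_prod m ?x \<longleftrightarrow> \<phi> g = y <# N"
    using coset_prod_almost_constant[of m y g] m_ge_3 True assms by (simp add: \<psi>_def)
  have "(\<forall>i\<in>{1..m}. \<forall>j\<in>{1..m}. ?x i <# M = ?x j <# M) \<longleftrightarrow> g <# M = y <# M"
    using m_ge_3 by (auto dest!: bspec[of _ _ 1] bspec[of _ _ 2])
  then have "?x \<in> K \<longleftrightarrow> g <# M = y <# M \<and> \<psi> y = coset_prod m ?x"
    using True assms m_ge_3 unfolding mem_K_iff by auto
  also have "\<dots> \<longleftrightarrow> g <# M = y <# M \<and> \<phi> g = y <# N"
    using * psi_cong[OF assms(2) True] by auto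
  finally show ?thesis using phi_cong[OF assms(2) True] True by auto
next
  case False
  then have "(\<lambda>i\<in>{1..m}. if i = 1 then y else g) \<notin> K"
    using m_ge_3 by (auto dest!: K_subset dest: PiE_mem[of _ _ _ 1])
  then show ?thesis using False by simp
qed

lemma phi_witness:
  assumes "g \<in> L"
  obtains y where "y \<in> L" "\<phi> g = y <# N" "(\<lambda>i\<in>{1..m}. if i = 1 then y else g) \<in> K"
proof -
  obtain y where y: "y \<in> L" "\<phi> g = y <# N"
    using phi_closed[OF assms] by (auto simp: carrier_Q)
  then show thesis
    using that almost_constant_mem_K_iff[of y g] assms by auto
qed

lemma L_of_K: "L_of K = L"
proof
  show "L_of K \<subseteq> L" using m_ge_3 by (auto simp: L_of_def dest!: K_subset)
next
  show "L \<subseteq> L_of K"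
  proof
    fix g assume "g \<in> L"
    then obtain y where y: "y \<in> L" "(\<lambda>i\<in>{1..m}. if i = 1 then y else g) \<in> K"
      by (rule phi_witness)
    let ?x = "\<lambda>i\<in>{1..m}. if i = 1 then y else g"
    \<comment> \<open>swapping the first two coordinates of \<open>(y, g, \<dots>, g)\<close> brings \<open>g\<close> to the front\<close>
    have tr: "transpose 1 2 permutes {1..m}"
      using m_ge_3 by (intro permutes_swap_id) auto
    have "?x \<in> carrier (power_group G m)"
      using y(1) \<open>g \<in> L\<close> by auto
    then have "(\<lambda>i\<in>{1..m}. ?x (transpose 1 2 i)) \<in> K"
      using K_inv_normal y(2) tr unfolding inv_normal_subgroup_def perm_invariant_def by blast
    moreover have "(\<lambda>i\<in>{1..m}. ?x (transpose 1 2 i)) 1 = g" using m_ge_3 by simp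
    ultimately show "g \<in> L_of K" unfolding L_of_def by (metis imageI)
  qed
qed

lemma N_of_K: "N_of G m K = N"
proof -
  have \<phi>1: "\<phi> \<one> = \<one>\<^bsub>Q\<^esub>"
    using phi_M[OF M.one_closed] by (simp add: coset_one)
  have "(\<lambda>i\<in>{1..m}. if i = 1 then n else \<one>) \<in> K \<longleftrightarrow> n \<in> N" if n: "n \<in> carrier G" for n
  proof -
    have "(\<lambda>i\<in>{1..m}. if i = 1 then n else \<one>) \<in> K \<longleftrightarrow> n \<in> L \<and> n <# N = \<one>\<^bsub>Q\<^esub>"
      using almost_constant_mem_K_iff[OF n L.one_closed] \<phi>1 by metis
    also have "\<dots> \<longleftrightarrow> n \<in> N" using coset_eq_one_iff N_le_L by blast
    finally show ?thesis .
  qed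
  then show ?thesis using N.subset unfolding N_of_def by blast
qed

lemma M_of_K: "M_of G m K = M"
proof
  show "M_of G m K \<subseteq> M"
  proof
    fix g assume "g \<in> M_of G m K"
    then obtain h where gh: "g \<in> carrier G"
        "(\<lambda>i\<in>{1..m}. if i = 1 then g else if i = 2 then h else \<one>) \<in> K"
      unfolding mem_M_of_iff by blast
    then have "g <# M = \<one> <# M"
    \<comment> \<open>the third coordinate exists and is trivial\<close>
    proof -
      let ?x = "\<lambda>i\<in>{1..m}. if i = 1 then g else if i = 2 then h else \<one>"
      have cong: "\<forall>i\<in>{1..m}. \<forall>j\<in>{1..m}. ?x i <# M = ?x j <# M"
        using gh(2) unfolding mem_K_iff by blast
      have "?x 1 <# M = ?x 3 <# M"
        by (rule cong[rule_format]) (use m_ge_3 in auto)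
      then show ?thesis using m_ge_3 by simp
    qed
    then show "g \<in> M" using M.l_coset_eq_iff[of g \<one>] gh by simp
  qed
next
  show "M \<subseteq> M_of G m K"
  proof
    fix g assume g: "g \<in> M"
    define x where "x = (\<lambda>i\<in>{1..m}. if i = 1 then g else if i = 2 then inv g else \<one>)"
    have gL: "g \<in> L" using g M_le_L by auto
    have x1: "x 1 = g" using m_ge_3 by (simp add: x_def)
    have xM: "x i \<in> M" if "i \<in> {1..m}" for i
      using that g by (simp add: x_def)
    have xL: "x \<in> {1..m} \<rightarrow>\<^sub>E L"
      unfolding x_def restrict_PiE_iff using gL by simp
    have "coset_prod m x = (g <# N) \<otimes>\<^bsub>Q\<^esub> (inv g <# N)"
      using m_ge_3 xL by (subst coset_prod_pair[of 1 m 2]) (auto simp: x_def)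
    then have "coset_prod m x = \<psi> (x 1)"
      using gL g x1 by (simp add: coset_inv psi_M)
    moreover have "x i <# M = M" if "i \<in> {1..m}" for i
      using xM[OF that] by (intro coset_join3 M.subgroup_axioms) auto
    ultimately have "x \<in> K"
      using xL unfolding mem_K_iff by simp
    then show "g \<in> M_of G m K"
      unfolding x_def mem_M_of_iff using M.mem_carrier[OF g] by blast
  qed
qed

lemma phi_of_K:
  assumes "g \<in> L"
  shows "phi_of G m K g = \<phi> g"
proof -
  obtain y where y: "y \<in> L" "\<phi> g = y <# N" "(\<lambda>i\<in>{1..m}. if i = 1 then y else g) \<in> K"
    using phi_witness[OF assms] .
  show ?thesis
    unfolding phi_of_def N_of_K
  proof (rule the_equality)
    show "\<exists>y\<in>carrier G. (\<lambda>i\<in>{1..m}. if i = 1 then y else g) \<in> K \<and> \<phi> g = y <# N"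
      using y by auto
  next
    fix C assume "\<exists>y\<in>carrier G. (\<lambda>i\<in>{1..m}. if i = 1 then y else g) \<in> K \<and> C = y <# N"
    then show "C = \<phi> g" using almost_constant_mem_K_iff[OF _ assms] by auto
  qed
qed

end

section \<open>The quadruple of an invariant normal subgroup\<close>

text \<open>
  The symmetric group is doubly transitive. The first transposition moves \<open>k\<close> to \<open>i\<close>; the second
  repairs the image of \<open>l\<close> and fixes \<open>i\<close>, because \<open>i\<close> is neither \<open>j\<close> nor the image of \<open>l\<close>.
\<close>
lemma exists_permutes_two_points:
  assumes "k \<in> S" "l \<in> S" "i \<in> S" "j \<in> S" "k \<noteq> l" "i \<noteq> j"
  obtains \<sigma> where "\<sigma> permutes S" "\<sigma> k = i" "\<sigma> l = j"
proof
  let ?\<tau> = "transpose k i"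
  let ?\<sigma> = "transpose (?\<tau> l) j \<circ> ?\<tau>"
  have l: "?\<tau> l \<in> S" using assms by (auto simp: transpose_def)
  show "?\<sigma> permutes S"
    using assms l by (intro permutes_compose permutes_swap_id)
  show "?\<sigma> k = i" "?\<sigma> l = j"
    using assms by (auto simp: transpose_def)
qed

locale invariant_subgroup = group G for G (structure) +
  fixes m :: nat and K :: "(nat \<Rightarrow> 'a) set"
  assumes m_ge_3: "3 \<le> m" and inv_normal: "inv_normal_subgroup G m K"
begin

abbreviation "LK \<equiv> L_of K"
abbreviation "MK \<equiv> M_of G m K"
abbreviation "NK \<equiv> N_of G m K"
abbreviation "phiK \<equiv> phi_of G m K"

lemma power_group_is_group: "group (power_group G m)"
  by (simp add: is_group)

sublocale KP: normal K "power_group G m"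
  using inv_normal by (simp add: inv_normal_subgroup_def)

lemma K_PiE: "x \<in> K \<Longrightarrow> x \<in> {1..m} \<rightarrow>\<^sub>E carrier G"
  using KP.subset by auto

lemma K_carrier: "x \<in> K \<Longrightarrow> i \<in> {1..m} \<Longrightarrow> x i \<in> carrier G"
  using K_PiE by blast

lemma K_mult: "x \<in> K \<Longrightarrow> y \<in> K \<Longrightarrow> (\<lambda>i\<in>{1..m}. x i \<otimes> y i) \<in> K"
  using subgroup.m_closed[OF KP.subgroup_axioms, of x y] unfolding mult_product_group by assumption

lemma K_inv: "x \<in> K \<Longrightarrow> (\<lambda>i\<in>{1..m}. inv (x i)) \<in> K"
  using KP.m_inv_closed[of x] K_PiE[of x] by (simp add: is_group)

lemma K_quot:
  assumes "x \<in> K" "y \<in> K"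
  shows "(\<lambda>i\<in>{1..m}. x i \<otimes> inv (y i)) \<in> K"
proof -
  have "(\<lambda>i\<in>{1..m}. x i \<otimes> (\<lambda>i\<in>{1..m}. inv (y i)) i) \<in> K"
    using assms by (intro K_mult K_inv)
  then show ?thesis by (simp cong: restrict_cong)
qed

lemma K_conj:
  assumes "g \<in> {1..m} \<rightarrow>\<^sub>E carrier G" "x \<in> K"
  shows "(\<lambda>i\<in>{1..m}. g i \<otimes> x i \<otimes> inv (g i)) \<in> K"
proof -
  have "(\<lambda>i\<in>{1..m}. (\<lambda>i\<in>{1..m}. g i \<otimes> x i) i \<otimes> (\<lambda>i\<in>{1..m}. inv (g i)) i) \<in> K"
    using KP.inv_op_closed2[of g x] assms by (simp add: is_group)
  then show ?thesis by (simp cong: restrict_cong)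
qed

lemma K_one: "(\<lambda>i\<in>{1..m}. \<one>) \<in> K"
  using subgroup.one_closed[OF KP.subgroup_axioms] unfolding one_product_group .

lemma K_perm:
  assumes "\<sigma> permutes {1..m}" "x \<in> K"
  shows "(\<lambda>i\<in>{1..m}. x (\<sigma> i)) \<in> K"
proof -
  have "perm_invariant G m K" using inv_normal by (simp add: inv_normal_subgroup_def)
  moreover have "x \<in> carrier (power_group G m)" using assms(2) KP.subset by blast
  ultimately have "x \<in> K \<longleftrightarrow> (\<lambda>i\<in>{1..m}. x (\<sigma> i)) \<in> K"
    using assms(1) unfolding perm_invariant_def by blast
  then show ?thesis using assms(2) by (rule iffD1)
qed

text \<open>
  The elements of \<open>H_of\<close> and of \<open>N_of\<close> are the cases \<open>i = 1\<close>, \<open>j = 2\<close>, the latter with \<open>b = \<one>\<close>.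
  For \<open>i = j\<close> the entry \<open>a\<close> takes precedence.
\<close>
definition two_point :: "nat \<Rightarrow> 'a \<Rightarrow> nat \<Rightarrow> 'a \<Rightarrow> nat \<Rightarrow> 'a" where
  "two_point i a j b = (\<lambda>k\<in>{1..m}. if k = i then a else if k = j then b else \<one>)"

lemma two_point_mult:
  assumes "two_point i a j b \<in> K" "two_point i c j d \<in> K"
  shows "two_point i (a \<otimes> c) j (b \<otimes> d) \<in> K"
proof -
  have "two_point i (a \<otimes> c) j (b \<otimes> d) = (\<lambda>k\<in>{1..m}. two_point i a j b k \<otimes> two_point i c j d k)"
    unfolding two_point_def by (rule restrict_ext) simp
  then show ?thesis using K_mult[OF assms] by simp
qed

lemma two_point_inv:
  assumes "two_point i a j b \<in> K"
  shows "two_point i (inv a) j (inv b) \<in> K"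
proof -
  have "two_point i (inv a) j (inv b) = (\<lambda>k\<in>{1..m}. inv (two_point i a j b k))"
    unfolding two_point_def by (rule restrict_ext) simp
  then show ?thesis using K_inv[OF assms] by simp
qed

lemma two_point_conj:
  assumes "two_point i a j b \<in> K" "g \<in> carrier G"
  shows "two_point i (g \<otimes> a \<otimes> inv g) j (g \<otimes> b \<otimes> inv g) \<in> K"
proof -
  let ?g = "\<lambda>k\<in>{1..m}. g"
  have "two_point i (g \<otimes> a \<otimes> inv g) j (g \<otimes> b \<otimes> inv g)
      = (\<lambda>k\<in>{1..m}. ?g k \<otimes> two_point i a j b k \<otimes> inv (?g k))"
    unfolding two_point_def using assms(2) by (intro restrict_ext) simp
  moreover have "?g \<in> {1..m} \<rightarrow>\<^sub>E carrier G" using assms(2) by simp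
  ultimately show ?thesis using K_conj[of ?g "two_point i a j b"] assms(1) by simp
qed

lemma two_point_one: "two_point i \<one> j \<one> \<in> K"
  using K_one unfolding two_point_def if_cancel .

text \<open>
  By invariance, the places of the two entries do not matter.
\<close>
lemma two_point_move:
  assumes "two_point i a j b \<in> K" "i \<in> {1..m}" "j \<in> {1..m}" "i \<noteq> j"
    "k \<in> {1..m}" "l \<in> {1..m}" "k \<noteq> l"
  shows "two_point k a l b \<in> K"
proof -
  obtain \<sigma> where \<sigma>: "\<sigma> permutes {1..m}" "\<sigma> k = i" "\<sigma> l = j"
    using exists_permutes_two_points[of k "{1..m}" l i j] assms by metis
  have "two_point k a l b p = two_point i a j b (\<sigma> p)" if p: "p \<in> {1..m}" for p
  proof -
    have "\<sigma> p \<in> {1..m}" using p permutes_in_image[OF \<sigma>(1)] by blast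
    moreover have "\<sigma> p = i \<longleftrightarrow> p = k" "\<sigma> p = j \<longleftrightarrow> p = l"
      using \<sigma> permutes_inj[OF \<sigma>(1)] by (metis injD)+
    ultimately show ?thesis using p by (simp add: two_point_def)
  qed
  then have "two_point k a l b = (\<lambda>p\<in>{1..m}. two_point i a j b (\<sigma> p))"
    unfolding two_point_def[of k a l b] by (intro restrict_ext) (simp add: two_point_def)
  then show ?thesis using K_perm[OF \<sigma>(1) assms(1)] by simp
qed

lemma indices [simp]: "1 \<in> {1..m}" "2 \<in> {1..m}" "Suc 0 \<le> m" "2 \<le> m"
  using m_ge_3 by auto

lemma mem_NK_iff: "n \<in> NK \<longleftrightarrow> n \<in> carrier G \<and> two_point 1 n 2 \<one> \<in> K"
  by (simp add: N_of_def two_point_def cong: if_cong)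

lemma mem_MK_iff: "a \<in> MK \<longleftrightarrow> a \<in> carrier G \<and> (\<exists>h\<in>carrier G. two_point 1 a 2 h \<in> K)"
  unfolding mem_M_of_iff two_point_def ..

lemma MK_I: "a \<in> carrier G \<Longrightarrow> h \<in> carrier G \<Longrightarrow> two_point 1 a 2 h \<in> K \<Longrightarrow> a \<in> MK"
  unfolding mem_MK_iff by blast

lemma MK_E:
  assumes "a \<in> MK"
  obtains h where "a \<in> carrier G" "h \<in> carrier G" "two_point 1 a 2 h \<in> K"
  using assms unfolding mem_MK_iff by blast

lemma NK_normal: "NK \<lhd> G"
proof (rule normal_invI)
  show "subgroup NK G"
  proof (rule subgroupI)
    show "NK \<noteq> {}" using two_point_one mem_NK_iff by blast
  next
    fix a assume "a \<in> NK"
    then show "inv a \<in> NK" using two_point_inv[of 1 a 2 \<one>] by (simp add: mem_NK_iff)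
  next
    fix a b assume "a \<in> NK" "b \<in> NK"
    then show "a \<otimes> b \<in> NK" using two_point_mult[of 1 a 2 \<one> b \<one>] by (simp add: mem_NK_iff)
  qed (auto simp: mem_NK_iff)
next
  fix g a assume "g \<in> carrier G" "a \<in> NK"
  then show "g \<otimes> a \<otimes> inv g \<in> NK"
    using two_point_conj[of 1 a 2 \<one> g] by (simp add: mem_NK_iff)
qed

lemma MK_normal: "MK \<lhd> G"
proof (rule normal_invI)
  show "subgroup MK G"
  proof (rule subgroupI)
    have "\<one> \<in> MK" by (rule MK_I[of _ \<one>]) (rule one_closed two_point_one)+
    then show "MK \<noteq> {}" by blast
  next
    fix a assume "a \<in> MK"
    then obtain h where "a \<in> carrier G" "h \<in> carrier G" "two_point 1 a 2 h \<in> K" by (rule MK_E)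
    then show "inv a \<in> MK" by (intro MK_I[OF _ _ two_point_inv[of 1 a 2 h]] inv_closed)
  next
    fix a b assume "a \<in> MK" "b \<in> MK"
    obtain h where h: "a \<in> carrier G" "h \<in> carrier G" "two_point 1 a 2 h \<in> K"
      using \<open>a \<in> MK\<close> by (rule MK_E)
    obtain k where k: "b \<in> carrier G" "k \<in> carrier G" "two_point 1 b 2 k \<in> K"
      using \<open>b \<in> MK\<close> by (rule MK_E)
    show "a \<otimes> b \<in> MK" using h k by (intro MK_I[OF _ _ two_point_mult[of 1 a 2 h b k]] m_closed)
  next
    show "MK \<subseteq> carrier G" by (rule subsetI) (erule MK_E)
  qed
next
  fix g a assume g: "g \<in> carrier G" and "a \<in> MK"
  obtain h where h: "a \<in> carrier G" "h \<in> carrier G" "two_point 1 a 2 h \<in> K"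
    using \<open>a \<in> MK\<close> by (rule MK_E)
  show "g \<otimes> a \<otimes> inv g \<in> MK" using g h by (intro MK_I[OF _ _ two_point_conj[of 1 a 2 h g]] m_closed inv_closed)
qed

lemma LK_normal: "LK \<lhd> G"
  unfolding L_of_def
proof (rule KP.surj_hom_normal_subgroup)
  show "group_hom (power_group G m) G (\<lambda>x. x 1)"
  proof (intro group_hom.intro group_hom_axioms.intro homI)
    fix x assume "x \<in> carrier (power_group G m)"
    then show "x 1 \<in> carrier G" unfolding carrier_product_group using indices(1) by (rule PiE_mem)
  next
    fix x y
    show "(x \<otimes>\<^bsub>power_group G m\<^esub> y) 1 = x 1 \<otimes> y 1"
      unfolding mult_product_group by (rule restrict_apply'[OF indices(1)])
  qed (rule power_group_is_group is_group)+
  show "(\<lambda>x. x 1) ` carrier (power_group G m) = carrier G"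
  proof
    show "(\<lambda>x. x 1) ` carrier (power_group G m) \<subseteq> carrier G"
      unfolding carrier_product_group using PiE_mem[OF _ indices(1)] by (intro image_subsetI)
    show "carrier G \<subseteq> (\<lambda>x. x 1) ` carrier (power_group G m)"
    proof
      fix g assume "g \<in> carrier G"
      then have "(\<lambda>i\<in>{1..m}. g) \<in> carrier (power_group G m)"
        unfolding carrier_product_group restrict_PiE_iff by blast
      moreover have "g = (\<lambda>i\<in>{1..m}. g) 1" by (rule restrict_apply'[OF indices(1), symmetric])
      ultimately show "g \<in> (\<lambda>x. x 1) ` carrier (power_group G m)"
        unfolding image_iff by (intro bexI[of _ "\<lambda>i\<in>{1..m}. g"])
    qed
  qed
qed

lemma K_LK:
  assumes "x \<in> K" "i \<in> {1..m}"
  shows "x i \<in> LK"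
proof -
  have "(\<lambda>k\<in>{1..m}. x (transpose 1 i k)) \<in> K"
    using assms by (intro K_perm permutes_swap_id) auto
  then have "(\<lambda>k\<in>{1..m}. x (transpose 1 i k)) 1 \<in> LK" unfolding L_of_def by (rule imageI)
  then show ?thesis by simp
qed

lemma NK_le_MK: "NK \<subseteq> MK"
  using one_closed by (auto simp: mem_NK_iff intro: MK_I)

lemma MK_le_LK: "MK \<subseteq> LK"
proof
  fix a assume "a \<in> MK"
  then obtain h where "two_point 1 a 2 h \<in> K" by (rule MK_E)
  from K_LK[OF this indices(1)] show "a \<in> LK" by (simp add: two_point_def)
qed

text \<open>
  Conjugating \<open>x \<in> K\<close> by \<open>g\<close> in the first coordinate only changes that coordinate alone, so dividing
  by \<open>x\<close> leaves a commutator at the first place and \<open>\<one>\<close> elsewhere.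
\<close>
lemma LK_central: "commutator_set G (carrier G) LK \<subseteq> NK"
proof
  fix c assume "c \<in> commutator_set G (carrier G) LK"
  then obtain g l where g: "g \<in> carrier G" and "l \<in> LK" and c: "c = g \<otimes> l \<otimes> inv g \<otimes> inv l"
    by (auto simp: commutator_set_def)
  then obtain x where x: "x \<in> K" and l: "l = x 1" by (auto simp: L_of_def)
  let ?g = "\<lambda>i\<in>{1..m}. if i = 1 then g else \<one>"
  have "?g \<in> {1..m} \<rightarrow>\<^sub>E carrier G" unfolding restrict_PiE_iff using g by simp
  from K_quot[OF K_conj[OF this x] x]
  have "(\<lambda>i\<in>{1..m}. (\<lambda>i\<in>{1..m}. ?g i \<otimes> x i \<otimes> inv (?g i)) i \<otimes> inv (x i)) \<in> K" .
  also have "(\<lambda>i\<in>{1..m}. (\<lambda>i\<in>{1..m}. ?g i \<otimes> x i \<otimes> inv (?g i)) i \<otimes> inv (x i)) = two_point 1 c 2 \<one>"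
    unfolding two_point_def c l using K_carrier[OF x] by (intro restrict_ext) auto
  finally show "c \<in> NK"
    using g K_carrier[OF x indices(1)] by (simp add: mem_NK_iff c l)
qed

sublocale central_section G LK NK
  by (rule central_section.intro[OF is_group central_section_axioms.intro
        [OF LK_normal NK_normal order_trans[OF NK_le_MK MK_le_LK] LK_central]])

sublocale MK: normal MK G by (rule MK_normal)

text \<open>
  An element \<open>a\<close> of \<open>M\<close> has a partner \<open>h\<close>. With a third place \<open>k\<close>, the quotient of the tuple with
  \<open>a\<close> at \<open>i\<close> by the tuple with \<open>a\<close> at \<open>j\<close>, both having \<open>h\<close> at \<open>k\<close>, gets rid of \<open>h\<close>.
\<close>
lemma two_point_inverse_mem_K:
  assumes a: "a \<in> MK" and ij: "i \<in> {1..m}" "j \<in> {1..m}" "i \<noteq> j"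
  shows "two_point i a j (inv a) \<in> K"
proof -
  have "\<exists>k\<in>{1,2,3}. k \<noteq> i \<and> k \<noteq> j" by auto
  then obtain k where k': "k \<in> {1,2,3}" "k \<noteq> i" "k \<noteq> j" by blast
  with m_ge_3 have k: "k \<in> {1..m}" "k \<noteq> i" "k \<noteq> j" by auto
  obtain h where h: "h \<in> carrier G" "two_point 1 a 2 h \<in> K" using a by (rule MK_E)
  have "two_point i a k h \<in> K" "two_point j a k h \<in> K"
    using two_point_move[OF h(2)] ij k by simp_all
  from K_quot[OF this]
  have "(\<lambda>p\<in>{1..m}. two_point i a k h p \<otimes> inv (two_point j a k h p)) \<in> K" .
  also have "(\<lambda>p\<in>{1..m}. two_point i a k h p \<otimes> inv (two_point j a k h p)) = two_point i a j (inv a)"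
    unfolding two_point_def using ij k h MK.mem_carrier[OF a] by (intro restrict_ext) simp
  finally show ?thesis .
qed

text \<open>
  Dividing \<open>x\<close> by the tuple with coordinates \<open>i\<close> and \<open>j\<close> swapped leaves only two nontrivial entries,
  so \<open>x i\<close> and \<open>x j\<close> differ by an element of \<open>M\<close>.
\<close>
lemma K_cong:
  assumes x: "x \<in> K" and ij: "i \<in> {1..m}" "j \<in> {1..m}"
  shows "x i <# MK = x j <# MK"
proof (cases "i = j")
  case False
  have c: "x i \<in> carrier G" "x j \<in> carrier G" using K_carrier[OF x] ij by auto
  have "(\<lambda>p\<in>{1..m}. x (transpose i j p)) \<in> K"
    using ij x by (intro K_perm permutes_swap_id)
  from K_quot[OF x this]
  have "(\<lambda>p\<in>{1..m}. x p \<otimes> inv ((\<lambda>p\<in>{1..m}. x (transpose i j p)) p)) \<in> K" .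
  also have "(\<lambda>p\<in>{1..m}. x p \<otimes> inv ((\<lambda>p\<in>{1..m}. x (transpose i j p)) p))
     = two_point i (x i \<otimes> inv (x j)) j (x j \<otimes> inv (x i))"
    unfolding two_point_def using K_carrier[OF x] by (intro restrict_ext) (simp add: transpose_def)
  finally have "two_point 1 (x i \<otimes> inv (x j)) 2 (x j \<otimes> inv (x i)) \<in> K"
    by (rule two_point_move) (use ij False in simp_all)
  from MK_I[OF _ _ this] have "x i \<otimes> inv (x j) \<in> MK" using c by simp
  then show ?thesis using MK.l_coset_eq_iff c by simp
qed simp

text \<open>
  Coordinates from 2 on can be prescribed in \<open>M\<close>, one after the other: each is produced by a two-point
  element whose inverse entry is collected at the first place.
\<close>
lemma exists_K_with_tail:
  assumes w: "\<And>i. i \<in> {2..m} \<Longrightarrow> w i \<in> MK"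
  shows "\<exists>z\<in>K. (\<forall>i\<in>{1..m}. z i \<in> MK) \<and> coset_prod m z = \<one>\<^bsub>Q\<^esub> \<and> (\<forall>i\<in>{2..m}. z i = w i)"
proof -
  have "\<exists>z\<in>K. (\<forall>i\<in>{1..m}. z i \<in> MK) \<and> coset_prod m z = \<one>\<^bsub>Q\<^esub> \<and>
          (\<forall>i\<in>S. z i = w i) \<and> (\<forall>i\<in>{2..m} - S. z i = \<one>)"
    if "finite S" "S \<subseteq> {2..m}" for S
    using that
  proof (induction S rule: finite_induct)
    case empty
    have prod: "coset_prod m (\<lambda>i\<in>{1..m}. \<one>) = \<one>\<^bsub>Q\<^esub>"
      unfolding coset_prod_def by (rule Q.finprod_one_eqI) (simp add: coset_one)
    show ?case by (intro bexI[OF _ K_one] conjI ballI prod) simp_all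
  next
    case (insert i S)
    have S: "S \<subseteq> {2..m}" and i2: "i \<in> {2..m}" using insert.prems by simp_all
    obtain z where z: "z \<in> K" and zM: "\<forall>k\<in>{1..m}. z k \<in> MK" and z_prod: "coset_prod m z = \<one>\<^bsub>Q\<^esub>"
      and zw: "\<forall>k\<in>S. z k = w k" and z1: "\<forall>k\<in>{2..m} - S. z k = \<one>"
      using insert.IH[OF S] by (elim bexE conjE)
    have i: "i \<in> {1..m}" "i \<noteq> 1" using i2 by auto
    define t where "t = two_point i (w i) 1 (inv (w i))"
    have wi: "w i \<in> MK" "w i \<in> carrier G" "w i \<in> LK"
      using w[OF i2] MK_le_LK MK.mem_carrier by blast+
    have t: "t \<in> K"
      unfolding t_def by (rule two_point_inverse_mem_K[OF wi(1) i(1) indices(1) i(2)])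
    have ti: "t i = w i" and t1: "t 1 = inv (w i)"
      using i by (simp_all add: t_def two_point_def)
    have tk: "t k = \<one>" if "k \<in> {1..m}" "k \<noteq> i" "k \<noteq> 1" for k
      using that by (simp add: t_def two_point_def)
    have tM: "t k \<in> MK" if "k \<in> {1..m}" for k
      using wi(1) ti t1 tk[OF that] by (cases "k = i \<or> k = 1") auto
    have "t \<in> {1..m} \<rightarrow> LK" "z \<in> {1..m} \<rightarrow> LK"
      using K_LK[OF t] K_LK[OF z] by blast+
    note tz = this
    have "coset_prod m t = (t i <# NK) \<otimes>\<^bsub>Q\<^esub> (t 1 <# NK)"
      by (rule coset_prod_pair[OF i(1) indices(1) i(2) tz(1) tk])
    also have "\<dots> = \<one>\<^bsub>Q\<^esub>"
      using wi(3) unfolding ti t1 by (simp add: coset_inv)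
    finally have t_prod: "coset_prod m t = \<one>\<^bsub>Q\<^esub>" .
    define z' where "z' = (\<lambda>k\<in>{1..m}. z k \<otimes> t k)"
    have z': "z' k = z k \<otimes> t k" if "k \<in> {1..m}" for k
      using that by (simp add: z'_def)
    have z'K: "z' \<in> K" unfolding z'_def by (rule K_mult[OF z t])
    have z'M: "z' k \<in> MK" if "k \<in> {1..m}" for k
      unfolding z'[OF that] using zM tM that by (intro MK.m_closed) blast+
    have z'_prod: "coset_prod m z' = \<one>\<^bsub>Q\<^esub>"
      unfolding z'_def coset_prod_mult[OF tz(2,1)] z_prod t_prod by simp
    have z'w: "z' k = w k" if k: "k \<in> insert i S" for k
    proof (cases "k = i")
      case True
      then have "z k = \<one>" using z1 i2 insert.hyps by blast
      then show ?thesis using True z'[OF i(1)] ti wi(2) by simp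
    next
      case False
      then have "k \<in> S" using k by blast
      moreover from this have k2: "k \<in> {2..m}" using S by blast
      then have "k \<in> {1..m}" "k \<noteq> 1" by auto
      ultimately show ?thesis
        using zw z' tk False MK.mem_carrier[OF w[OF k2]] by simp
    qed
    have z'1: "z' k = \<one>" if k: "k \<in> {2..m} - insert i S" for k
    proof -
      have "k \<in> {1..m}" "k \<noteq> i" "k \<noteq> 1" "z k = \<one>" using k z1 by auto
      then show ?thesis using z' tk by simp
    qed
    show ?case by (intro bexI[of _ z'] conjI ballI z'K z'M z'_prod z'w z'1)
  qed
  from this[of "{2..m}"] show ?thesis by auto
qed

text \<open>
  An element of \<open>K\<close> with the coordinates of \<open>w\<close> from 2 on and trivial product differs from \<open>w\<close> at the
  first place only, and there by an element of \<open>N\<close> because the products agree modulo \<open>N\<close>.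
\<close>
lemma MK_power_mem_K:
  assumes w: "w \<in> {1..m} \<rightarrow>\<^sub>E MK" and prod: "coset_prod m w = \<one>\<^bsub>Q\<^esub>"
  shows "w \<in> K"
proof -
  have wM: "w i \<in> MK" if "i \<in> {1..m}" for i using w that by blast
  then have "\<And>i. i \<in> {2..m} \<Longrightarrow> w i \<in> MK" by simp
  from exists_K_with_tail[of w, OF this]
  obtain z where z: "z \<in> K" "\<And>k. k \<in> {1..m} \<Longrightarrow> z k \<in> MK" "coset_prod m z = \<one>\<^bsub>Q\<^esub>"
      "\<And>k. k \<in> {2..m} \<Longrightarrow> z k = w k" by auto
  have wL: "w \<in> {1..m} \<rightarrow> LK" and zL: "z \<in> {1..m} \<rightarrow> LK"
    and iL: "(\<lambda>k\<in>{1..m}. inv (z k)) \<in> {1..m} \<rightarrow> LK"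
    using wM z(2) MK_le_LK by auto
  have wc: "w k \<in> carrier G" and zc: "z k \<in> carrier G" if "k \<in> {1..m}" for k
    using that wM z(2) by (auto intro: MK.mem_carrier)
  define u where "u = (\<lambda>k\<in>{1..m}. w k \<otimes> inv (z k))"
  have u: "u = two_point 1 (w 1 \<otimes> inv (z 1)) 2 \<one>"
    unfolding u_def two_point_def
  proof (rule restrict_ext)
    fix k assume k: "k \<in> {1..m}"
    show "w k \<otimes> inv (z k) = (if k = 1 then w 1 \<otimes> inv (z 1) else if k = 2 then \<one> else \<one>)"
    proof (cases "k = 1")
      case False
      then have "z k = w k" using k by (intro z(4)) auto
      then show ?thesis using False wc[OF k] by simp
    qed simp
  qed
  have u1: "w 1 \<otimes> inv (z 1) \<in> LK"
    using wM[OF indices(1)] z(2)[OF indices(1)] MK_le_LK by auto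
  have "coset_prod m u = coset_prod m (\<lambda>k\<in>{1..m}. w k \<otimes> (\<lambda>k\<in>{1..m}. inv (z k)) k)"
    unfolding u_def by (simp cong: restrict_cong)
  also have "\<dots> = \<one>\<^bsub>Q\<^esub>"
    using coset_prod_mult[OF wL iL] coset_prod_inv[OF zL] prod z(3) by simp
  also have "coset_prod m u = (u 1 <# NK) \<otimes>\<^bsub>Q\<^esub> (u 2 <# NK)"
    using u1 by (intro coset_prod_pair) (auto simp: u two_point_def)
  finally have "w 1 \<otimes> inv (z 1) \<in> NK"
    using u1 by (simp add: u two_point_def coset_one coset_eq_one_iff)
  then have "u \<in> K" unfolding mem_NK_iff u by blast
  from K_mult[OF this z(1)] have "(\<lambda>k\<in>{1..m}. u k \<otimes> z k) \<in> K" .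
  also have "(\<lambda>k\<in>{1..m}. u k \<otimes> z k) = (\<lambda>k\<in>{1..m}. w k)"
    using wc zc by (intro restrict_ext) (simp add: u_def m_assoc)
  also have "\<dots> = w" using w by (rule PiE_restrict)
  finally show ?thesis .
qed

text \<open>
  The coordinatewise quotient of the two tuples is an element of \<open>M\<^sup>m\<close> with product in \<open>N\<close>.
\<close>
lemma K_transfer:
  assumes z: "z \<in> K" and x: "x \<in> {1..m} \<rightarrow>\<^sub>E LK"
    and cong: "\<And>i. i \<in> {1..m} \<Longrightarrow> x i <# MK = z i <# MK"
    and prod: "coset_prod m x = coset_prod m z"
  shows "x \<in> K"
proof -
  have xL: "x \<in> {1..m} \<rightarrow> LK" and zL: "z \<in> {1..m} \<rightarrow> LK"
    and iL: "(\<lambda>k\<in>{1..m}. inv (z k)) \<in> {1..m} \<rightarrow> LK"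
    using x K_LK[OF z] by auto
  have xc: "x k \<in> carrier G" and zc: "z k \<in> carrier G" if "k \<in> {1..m}" for k
    using that xL zL by (blast intro: L.mem_carrier)+
  define w where "w = (\<lambda>k\<in>{1..m}. x k \<otimes> inv (z k))"
  have "coset_prod m w = coset_prod m (\<lambda>k\<in>{1..m}. x k \<otimes> (\<lambda>k\<in>{1..m}. inv (z k)) k)"
    unfolding w_def by (simp cong: restrict_cong)
  also have "\<dots> = \<one>\<^bsub>Q\<^esub>"
    using coset_prod_mult[OF xL iL] coset_prod_inv[OF zL] zL prod by simp
  finally have "w \<in> K"
    using cong xc zc MK.l_coset_eq_iff by (intro MK_power_mem_K) (simp_all add: w_def)
  from K_mult[OF this z] have "(\<lambda>k\<in>{1..m}. w k \<otimes> z k) \<in> K" .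
  also have "(\<lambda>k\<in>{1..m}. w k \<otimes> z k) = (\<lambda>k\<in>{1..m}. x k)"
    using xc zc by (intro restrict_ext) (simp add: w_def m_assoc)
  also have "\<dots> = x" using x by (rule PiE_restrict)
  finally show ?thesis .
qed

abbreviation almost_constant :: "'a \<Rightarrow> 'a \<Rightarrow> nat \<Rightarrow> 'a" where
  "almost_constant y g \<equiv> (\<lambda>i\<in>{1..m}. if i = 1 then y else g)"

text \<open>
  Two choices of \<open>y\<close> give tuples in \<open>K\<close> whose quotient is trivial outside the first place, so the
  choices differ by an element of \<open>N\<close>.
\<close>
lemma phiK_eq:
  assumes "almost_constant y g \<in> K"
  shows "phiK g = y <# NK"
proof -
  have y: "y \<in> carrier G" and g: "g \<in> carrier G"
    using K_carrier[OF assms indices(1)] K_carrier[OF assms indices(2)] by simp_all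
  show ?thesis
    unfolding phi_of_def
  proof (rule the_equality)
    show "\<exists>y'\<in>carrier G. almost_constant y' g \<in> K \<and> y <# NK = y' <# NK"
      using y assms by blast
  next
    fix C assume "\<exists>y'\<in>carrier G. almost_constant y' g \<in> K \<and> C = y' <# NK"
    then obtain y' where y': "y' \<in> carrier G" "almost_constant y' g \<in> K" "C = y' <# NK" by blast
    from K_quot[OF y'(2) assms]
    have "(\<lambda>i\<in>{1..m}. almost_constant y' g i \<otimes> inv (almost_constant y g i)) \<in> K" .
    also have "(\<lambda>i\<in>{1..m}. almost_constant y' g i \<otimes> inv (almost_constant y g i))
       = two_point 1 (y' \<otimes> inv y) 2 \<one>"
      unfolding two_point_def using g by (intro restrict_ext) simp
    finally have "y' \<otimes> inv y \<in> NK" using y y' by (simp add: mem_NK_iff)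
    then show "C = y <# NK" using y y' N.l_coset_eq_iff by simp
  qed
qed

text \<open>
  All coordinates of \<open>x\<close> are congruent to \<open>x 1\<close> modulo \<open>M\<close>, so they can be made equal to \<open>x 1\<close>, except
  for the first, by multiplying with an element of \<open>K \<inter> M\<^sup>m\<close> of trivial product.
\<close>
lemma K_almost_constant_representative:
  assumes x: "x \<in> K"
  obtains y where "y \<in> LK" "almost_constant y (x 1) \<in> K"
    "coset_prod m (almost_constant y (x 1)) = coset_prod m x"
proof -
  \<comment> \<open>the factor that turns \<open>x i\<close> into \<open>x 1\<close>\<close>
  define w where "w i = inv (x i) \<otimes> x 1" for i
  have xc: "x k \<in> carrier G" if "k \<in> {1..m}" for k using K_carrier[OF x that] .
  have "w i \<in> MK" if "i \<in> {2..m}" for i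
  proof -
    have i: "i \<in> {1..m}" using that by simp
    have "inv (x i) <# MK = inv (x 1) <# MK"
      using K_cong[OF x i indices(1)] xc i by (simp only: MK.l_coset_inv indices)
    then show ?thesis
      using MK.l_coset_eq_iff[of "inv (x i)" "inv (x 1)"] xc[OF i] xc[OF indices(1)]
      by (simp add: w_def)
  qed
  from exists_K_with_tail[of w, OF this]
  obtain z where z: "z \<in> K" "coset_prod m z = \<one>\<^bsub>Q\<^esub>" "\<And>k. k \<in> {2..m} \<Longrightarrow> z k = w k" by auto
  have eq: "(\<lambda>k\<in>{1..m}. x k \<otimes> z k) = almost_constant (x 1 \<otimes> z 1) (x 1)"
  proof (rule restrict_ext)
    fix k assume k: "k \<in> {1..m}"
    show "x k \<otimes> z k = (if k = 1 then x 1 \<otimes> z 1 else x 1)"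
    proof (cases "k = 1")
      case False
      then have "z k = w k" using k by (intro z(3)) auto
      then show ?thesis
        using False xc[OF k] xc[OF indices(1)] by (simp add: w_def m_assoc[symmetric])
    qed simp
  qed
  have "almost_constant (x 1 \<otimes> z 1) (x 1) \<in> K"
    using K_mult[OF x z(1)] unfolding eq .
  moreover have "x 1 \<otimes> z 1 \<in> LK"
    using K_LK[OF x indices(1)] K_LK[OF z(1) indices(1)] by simp
  moreover have "coset_prod m (almost_constant (x 1 \<otimes> z 1) (x 1)) = coset_prod m x"
    using coset_prod_mult[of x m z] K_LK[OF x] K_LK[OF z(1)] z(2) unfolding eq by simp
  ultimately show thesis using that by blast
qed

lemma phiK_witness:
  assumes "g \<in> LK"
  obtains y where "y \<in> LK" "almost_constant y g \<in> K" "phiK g = y <# NK" "y <# MK = g <# MK"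
proof -
  obtain x where x: "x \<in> K" "g = x 1" using assms by (auto simp: L_of_def)
  obtain y where y: "y \<in> LK" "almost_constant y g \<in> K"
    using K_almost_constant_representative[OF x(1)] x(2) by metis
  have "almost_constant y g 1 <# MK = almost_constant y g 2 <# MK"
    using y(2) by (intro K_cong indices)
  then have "y <# MK = g <# MK" by simp
  then show thesis using that y phiK_eq[OF y(2)] by blast
qed

lemma phiK_closed [simp]: "g \<in> LK \<Longrightarrow> phiK g \<in> carrier Q"
  by (metis phiK_witness coset_closed)

lemma phiK_hom: "phiK \<in> hom (G\<lparr>carrier := LK\<rparr>) Q"
proof (rule homI)
  fix g h assume "g \<in> carrier (G\<lparr>carrier := LK\<rparr>)" "h \<in> carrier (G\<lparr>carrier := LK\<rparr>)"
  then have gh: "g \<in> LK" "h \<in> LK" by simp_all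
  obtain y where y: "y \<in> LK" "almost_constant y g \<in> K" "phiK g = y <# NK"
    using phiK_witness[OF gh(1)] .
  obtain z where z: "z \<in> LK" "almost_constant z h \<in> K" "phiK h = z <# NK"
    using phiK_witness[OF gh(2)] .
  have "almost_constant (y \<otimes> z) (g \<otimes> h)
     = (\<lambda>i\<in>{1..m}. almost_constant y g i \<otimes> almost_constant z h i)"
    by (rule restrict_ext) simp
  then have "almost_constant (y \<otimes> z) (g \<otimes> h) \<in> K"
    using K_mult[OF y(2) z(2)] by simp
  from phiK_eq[OF this]
  show "phiK (g \<otimes>\<^bsub>G\<lparr>carrier := LK\<rparr>\<^esub> h) = phiK g \<otimes>\<^bsub>Q\<^esub> phiK h"
    using y z by (simp add: coset_mult)
qed simp

text \<open>
  The tuple with first coordinate \<open>g [^] (1 - m)\<close> and all others equal to \<open>g\<close> has trivial product, so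
  \<open>MK_power_mem_K\<close> puts it into \<open>K\<close>.
\<close>
lemma phiK_MK:
  assumes g: "g \<in> MK"
  shows "phiK g = (g [^] (1 - int m)) <# NK"
proof (rule phiK_eq, rule MK_power_mem_K)
  have gL: "g \<in> LK" using g MK_le_LK by blast
  have "g [^] (1 - int m) \<in> MK"
    using g by (rule subgroup_int_pow_closed[OF MK.subgroup_axioms])
  then show "almost_constant (g [^] (1 - int m)) g \<in> {1..m} \<rightarrow>\<^sub>E MK"
    unfolding restrict_PiE_iff using g by simp
  show "coset_prod m (almost_constant (g [^] (1 - int m)) g) = \<one>\<^bsub>Q\<^esub>"
    using coset_prod_almost_constant[of m "g [^] (1 - int m)" g] gL
      Q.int_pow_mult[of "g <# NK" "1 - int m" "int m - 1", symmetric]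
      subgroup_int_pow_closed[OF L.subgroup_axioms gL]
    by (simp add: coset_int_pow)
qed

text \<open>
  For the last condition on \<open>\<phi>\<^sub>K\<close>: if \<open>\<phi>\<^sub>K g = h N\<close>, then \<open>h\<close> agrees modulo \<open>N\<close> with some \<open>y\<close> for which
  \<open>(y, g, \<dots>, g)\<close> lies in \<open>K\<close>, and the coordinates of this tuple agree modulo \<open>M\<close>.
\<close>
lemma quadruple: "invariant_quadruple G m LK MK NK phiK"
proof -
  have "g <# MK = h <# MK" if gh: "g \<in> LK" "h \<in> LK" "phiK g = h <# NK" for g h
  proof -
    obtain y where y: "y \<in> LK" "phiK g = y <# NK" "y <# MK = g <# MK"
      using phiK_witness[OF gh(1)] .
    have "y \<otimes> inv h \<in> NK" using N.l_coset_eq_iff[of y h] y gh by auto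
    then have "y <# MK = h <# MK" using MK.l_coset_eq_iff[of y h] NK_le_MK y gh by auto
    then show ?thesis using y by simp
  qed
  then show ?thesis
    unfolding invariant_quadruple_def LMNm_hom_def
    using LK_normal MK_normal NK_normal NK_le_MK MK_le_LK LK_central phiK_hom phiK_MK
    by (simp add: Q_def)
qed

text \<open>
  The map \<open>\<phi>\<^sub>K\<close> is read off from a representative \<open>(y, x\<^sub>1, \<dots>, x\<^sub>1)\<close> with the product of \<open>x\<close>.
\<close>
lemma phiK_equation:
  assumes x: "x \<in> K"
  shows "phiK (x 1) \<otimes>\<^bsub>Q\<^esub> ((x 1 <# NK) [^]\<^bsub>Q\<^esub> (int m - 1)) = coset_prod m x"
proof -
  obtain y where y: "y \<in> LK" "almost_constant y (x 1) \<in> K"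
    "coset_prod m (almost_constant y (x 1)) = coset_prod m x"
    using K_almost_constant_representative[OF x] .
  then show ?thesis
    using coset_prod_almost_constant[of m y "x 1"] K_LK[OF x indices(1)] phiK_eq[OF y(2)] by simp
qed

text \<open>
  A tuple satisfying the defining conditions is congruent modulo \<open>M\<close> to \<open>(y, x\<^sub>1, \<dots>, x\<^sub>1)\<close> and has the
  same product, where \<open>y\<close> represents \<open>\<phi>\<^sub>K x\<^sub>1\<close>; so \<open>K_transfer\<close> applies.
\<close>
lemma K_eq: "K = K_of G m LK MK NK phiK"
proof
  show "K \<subseteq> K_of G m LK MK NK phiK"
  proof
    fix x assume x: "x \<in> K"
    have xL: "x \<in> {1..m} \<rightarrow>\<^sub>E LK"
      using K_LK[OF x] K_PiE[OF x] by (simp add: PiE_iff)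
    have "phiK (x 1) = (x 1 [^] (2 - int m) \<otimes> foldr (\<otimes>) (map x [2..<Suc m]) \<one>) <# NK"
      using defining_equation_iff[of m x "phiK (x 1)"] xL phiK_equation[OF x] K_LK[OF x] by auto
    then show "x \<in> K_of G m LK MK NK phiK"
      unfolding K_of_def using xL K_cong[OF x] by blast
  qed
next
  show "K_of G m LK MK NK phiK \<subseteq> K"
  proof
    fix x assume x: "x \<in> K_of G m LK MK NK phiK"
    then have xL: "x \<in> {1..m} \<rightarrow>\<^sub>E LK"
      and cong: "\<And>i j. i \<in> {1..m} \<Longrightarrow> j \<in> {1..m} \<Longrightarrow> x i <# MK = x j <# MK"
      and eq: "phiK (x 1) = (x 1 [^] (2 - int m) \<otimes> foldr (\<otimes>) (map x [2..<Suc m]) \<one>) <# NK"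
      unfolding K_of_def by blast+
    have x1: "x 1 \<in> LK" using xL indices(1) by blast
    obtain y where y: "y \<in> LK" "almost_constant y (x 1) \<in> K" "y <# MK = x 1 <# MK"
      using phiK_witness[OF x1] .
    have "coset_prod m x = phiK (x 1) \<otimes>\<^bsub>Q\<^esub> ((x 1 <# NK) [^]\<^bsub>Q\<^esub> (int m - 1))"
      using iffD1[OF defining_equation_iff[OF _ _ phiK_closed[OF x1]] eq] xL indices(3)
      by (simp add: PiE_def)
    also have "\<dots> = coset_prod m (almost_constant y (x 1))"
      using coset_prod_almost_constant[of m y "x 1"] y x1 phiK_eq[OF y(2)] by simp
    finally have prod: "coset_prod m x = coset_prod m (almost_constant y (x 1))" .
    have "x i <# MK = almost_constant y (x 1) i <# MK" if "i \<in> {1..m}" for i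
      using cong[OF that indices(1)] y(3) that by simp
    then show "x \<in> K" using prod by (rule K_transfer[OF y(2) xL])
  qed
qed

end

section \<open>The correspondence\<close>

theorem theorem4p8:
  fixes G :: "('a, 'b) monoid_scheme" and m :: nat
  assumes "group G" and "m \<ge> 3"
  shows "(\<forall>L M N \<phi>. invariant_quadruple G m L M N \<phi> \<longrightarrow>
            inv_normal_subgroup G m (K_of G m L M N \<phi>) \<and>
            L_of (K_of G m L M N \<phi>) = L \<and>
            M_of G m (K_of G m L M N \<phi>) = M \<and>
            N_of G m (K_of G m L M N \<phi>) = N \<and>
            (\<forall>g\<in>L. phi_of G m (K_of G m L M N \<phi>) g = \<phi> g))
       \<and> (\<forall>K. inv_normal_subgroup G m K \<longrightarrow>
            invariant_quadruple G m (L_of K) (M_of G m K) (N_of G m K) (phi_of G m K) \<and>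
            K = K_of G m (L_of K) (M_of G m K) (N_of G m K) (phi_of G m K))"
proof (intro conjI allI impI)
  fix L M N \<phi> assume "invariant_quadruple G m L M N \<phi>"
  then interpret invariant_quad G m L M N \<phi>
    using assms by (simp add: invariant_quad_def invariant_quad_axioms_def)
  show "inv_normal_subgroup G m K" "L_of K = L" "M_of G m K = M" "N_of G m K = N"
    "\<forall>g\<in>L. phi_of G m K g = \<phi> g"
    using K_inv_normal L_of_K M_of_K N_of_K phi_of_K by blast+
next
  fix K assume "inv_normal_subgroup G m K"
  then interpret invariant_subgroup G m K
    using assms by (simp add: invariant_subgroup_def invariant_subgroup_axioms_def)
  show "invariant_quadruple G m (L_of K) (M_of G m K) (N_of G m K) (phi_of G m K)"
    by (rule quadruple)
  show "K = K_of G m (L_of K) (M_of G m K) (N_of G m K) (phi_of G m K)"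
    by (rule K_eq)
qed

end
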